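(* Let $G$ be a balanced bipartite graph with $2n$ vertices and let $q\ge 0$ be an integer. (i) $G$ is $(q,q)$-Hamiltonian if and only if $\mathscr{B}_{n+q+1}(G)$ is $(q,q)$-Hamiltonian. (ii) $G$ is $(q,q)$-traceable if and only if $\mathscr{B}_{n+q+1}(G)$ is $(q,q)$-traceable.
   Context: Graphs are finite, simple and undirected. $G=[U,V]$ denotes a bipartite graph with vertex bipartition $(U,V)$; it is balanced if $|U|=|V|$. A graph is Hamiltonian (resp. traceable) if it contains a spanning cycle (resp. spanning path). For a balanced bipartite graph $G=[U,V]$ and integer $q\ge0$: $G$ is $(q,q)$-Hamiltonian (resp. $(q,q)$-traceable) if for every $S\subset V(G)$ with $|S\cap U|=|S\cap V|=q$, the graph $G-S$ is Hamiltonian (resp. traceable). For an integer $\ell>0$ and a bipartite graph $G=[U,V]$, the bipartite closure $\mathscr{B}_\ell(G)$ is the bipartite graph obtained from $G$ by recursively joining pairs of nonadjacent vertices $u\in U$, $v\in V$ whose degree sum (in the current graph) is at least $\ell$ until no such pair remains nonadjacent. *)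

theory Defs
  imports Main
begin

text \<open>
  A finite simple undirected graph is given by a vertex set \<open>W\<close> and a set \<open>E\<close> of edges, each edge
  being a two-element subset of \<open>W\<close>. A bipartite graph \<open>G = [U, V]\<close> has vertex set \<open>U \<union> V\<close>.
\<close>

definition bipartite_graph :: "'a set \<Rightarrow> 'a set \<Rightarrow> 'a set set \<Rightarrow> bool" where
  "bipartite_graph U V E \<longleftrightarrow>
     finite U \<and> finite V \<and> U \<inter> V = {} \<and> (\<forall>e\<in>E. \<exists>u\<in>U. \<exists>v\<in>V. e = {u, v})"

definition balanced_bipartite_graph :: "'a set \<Rightarrow> 'a set \<Rightarrow> 'a set set \<Rightarrow> bool" where
  "balanced_bipartite_graph U V E \<longleftrightarrow> bipartite_graph U V E \<and> card U = card V"

definition degree :: "'a set set \<Rightarrow> 'a \<Rightarrow> nat" where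
  "degree E x = card {y. {x, y} \<in> E}"

definition is_path :: "'a set set \<Rightarrow> 'a list \<Rightarrow> bool" where
  "is_path E xs \<longleftrightarrow> xs \<noteq> [] \<and> distinct xs \<and> successively (\<lambda>x y. {x, y} \<in> E) xs"

text \<open>
  A cycle is listed without repeating its first vertex. The length bound excludes the degenerate
  closed walk that traverses a single edge back and forth.
\<close>

definition is_cycle :: "'a set set \<Rightarrow> 'a list \<Rightarrow> bool" where
  "is_cycle E xs \<longleftrightarrow> is_path E xs \<and> length xs \<ge> 3 \<and> {last xs, hd xs} \<in> E"

definition hamiltonian :: "'a set \<Rightarrow> 'a set set \<Rightarrow> bool" where
  "hamiltonian W E \<longleftrightarrow> (\<exists>xs. is_cycle E xs \<and> set xs = W)"

definition traceable :: "'a set \<Rightarrow> 'a set set \<Rightarrow> bool" where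
  "traceable W E \<longleftrightarrow> (\<exists>xs. is_path E xs \<and> set xs = W)"

definition delete_vertices :: "'a set set \<Rightarrow> 'a set \<Rightarrow> 'a set set" where
  "delete_vertices E S = {e \<in> E. e \<inter> S = {}}"

definition qq_hamiltonian :: "nat \<Rightarrow> 'a set \<Rightarrow> 'a set \<Rightarrow> 'a set set \<Rightarrow> bool" where
  "qq_hamiltonian q U V E \<longleftrightarrow>
     (\<forall>S. S \<subseteq> U \<union> V \<and> card (S \<inter> U) = q \<and> card (S \<inter> V) = q
        \<longrightarrow> hamiltonian ((U \<union> V) - S) (delete_vertices E S))"

definition qq_traceable :: "nat \<Rightarrow> 'a set \<Rightarrow> 'a set \<Rightarrow> 'a set set \<Rightarrow> bool" where
  "qq_traceable q U V E \<longleftrightarrow>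
     (\<forall>S. S \<subseteq> U \<union> V \<and> card (S \<inter> U) = q \<and> card (S \<inter> V) = q
        \<longrightarrow> traceable ((U \<union> V) - S) (delete_vertices E S))"

inductive closure_step :: "nat \<Rightarrow> 'a set \<Rightarrow> 'a set \<Rightarrow> 'a set set \<Rightarrow> 'a set set \<Rightarrow> bool"
  for l :: nat and U V :: "'a set" where
  join: "\<lbrakk>u \<in> U; v \<in> V; {u, v} \<notin> E; degree E u + degree E v \<ge> l\<rbrakk>
     \<Longrightarrow> closure_step l U V E (insert {u, v} E)"

definition is_bipartite_closure ::
  "nat \<Rightarrow> 'a set \<Rightarrow> 'a set \<Rightarrow> 'a set set \<Rightarrow> 'a set set \<Rightarrow> bool" where
  "is_bipartite_closure l U V E H \<longleftrightarrow>
     (closure_step l U V)\<^sup>*\<^sup>* E H \<and> (\<nexists>H'. closure_step l U V H H')"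

text \<open>
  The edge set of the bipartite closure; the vertex classes are those of the original graph.
  The result does not depend on the order in which edges are added, see
  \<open>ex1_bipartite_closure\<close> below.
\<close>

definition bipartite_closure :: "nat \<Rightarrow> 'a set \<Rightarrow> 'a set \<Rightarrow> 'a set set \<Rightarrow> 'a set set" where
  "bipartite_closure l U V E = (THE H. is_bipartite_closure l U V E H)"

lemma bipartite_graph_step:
  assumes "closure_step l U V E E'" "bipartite_graph U V E"
  shows "bipartite_graph U V E'"
  using assms by (cases rule: closure_step.cases) (auto simp: bipartite_graph_def)

lemma bipartite_graph_steps:
  assumes "(closure_step l U V)\<^sup>*\<^sup>* E E'" "bipartite_graph U V E"
  shows "bipartite_graph U V E'"
  using assms by (induction rule: rtranclp_induct) (auto intro: bipartite_graph_step)

lemma finite_neighbours: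
  assumes "bipartite_graph U V E"
  shows "finite {y. {x, y} \<in> E}"
proof (rule finite_subset)
  show "{y. {x, y} \<in> E} \<subseteq> U \<union> V"
    using assms unfolding bipartite_graph_def by (auto simp: doubleton_eq_iff)
  show "finite (U \<union> V)"
    using assms by (simp add: bipartite_graph_def)
qed

lemma degree_mono:
  assumes "bipartite_graph U V H" "E \<subseteq> H"
  shows "degree E x \<le> degree H x"
  unfolding degree_def
  by (rule card_mono[OF finite_neighbours[OF assms(1)]]) (use assms(2) in auto)

lemma steps_subset_closure:
  assumes "(closure_step l U V)\<^sup>*\<^sup>* E E'" "bipartite_graph U V E"
    and "is_bipartite_closure l U V E H"
  shows "E' \<subseteq> H"
  using assms(1)
proof (induction rule: rtranclp_induct)
  case base
  have "(closure_step l U V)\<^sup>*\<^sup>* E H"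
    using assms(3) by (simp add: is_bipartite_closure_def)
  then show ?case
    by (induction rule: rtranclp_induct) (auto elim!: closure_step.cases)
next
  case (step F F')
  have H: "bipartite_graph U V H"
    using assms(2,3) bipartite_graph_steps unfolding is_bipartite_closure_def by blast
  from step.hyps(2) obtain u v where uv: "u \<in> U" "v \<in> V"
      "degree F u + degree F v \<ge> l" "F' = insert {u, v} F"
    by (auto elim: closure_step.cases)
  have "degree H u + degree H v \<ge> l"
    using uv(3) degree_mono[OF H step.IH, of u] degree_mono[OF H step.IH, of v] by linarith
  then have "{u, v} \<in> H"
    using assms(3) uv(1,2) closure_step.join unfolding is_bipartite_closure_def by metis
  then show ?case
    using step.IH uv(4) by simp
qed

lemma ex_bipartite_closure:
  assumes "bipartite_graph U V E"
  shows "\<exists>H. is_bipartite_closure l U V E H"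
  using assms
proof (induction "card (Pow (U \<union> V) - E)" arbitrary: E rule: less_induct)
  case less
  show ?case
  proof (cases "\<exists>E'. closure_step l U V E E'")
    case False
    then show ?thesis
      unfolding is_bipartite_closure_def by blast
  next
    case True
    then obtain E' where E': "closure_step l U V E E'" by blast
    then obtain u v where uv: "u \<in> U" "v \<in> V" "{u, v} \<notin> E" "E' = insert {u, v} E"
      by (auto elim: closure_step.cases)
    have "finite (Pow (U \<union> V) - E)"
      using less.prems by (simp add: bipartite_graph_def)
    then have "card (Pow (U \<union> V) - E') < card (Pow (U \<union> V) - E)"
      by (rule psubset_card_mono) (use uv in auto)
    with less.hyps bipartite_graph_step[OF E' less.prems] obtain H
      where "is_bipartite_closure l U V E' H" by blast
    with E' show ?thesis
      unfolding is_bipartite_closure_def by (meson converse_rtranclp_into_rtranclp)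
  qed
qed

lemma ex1_bipartite_closure:
  assumes "bipartite_graph U V E"
  shows "\<exists>!H. is_bipartite_closure l U V E H"
proof -
  have "H = H'" if "is_bipartite_closure l U V E H" "is_bipartite_closure l U V E H'" for H H'
    using that steps_subset_closure[OF _ assms]
    by (meson is_bipartite_closure_def subset_antisym)
  then show ?thesis
    using ex_bipartite_closure[OF assms] by blast
qed

lemma is_bipartite_closure_bipartite_closure:
  assumes "bipartite_graph U V E"
  shows "is_bipartite_closure l U V E (bipartite_closure l U V E)"
  unfolding bipartite_closure_def by (rule theI'[OF ex1_bipartite_closure[OF assms]])

end

theory Submission
  imports Defs
begin

text \<open>
  It suffices that a single joining step preserves and reflects both properties; going from a
  graph to a larger one is trivial, so only reflection needs an argument. Fix a deleted set \<open>S\<close>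
  with \<open>q\<close> vertices in each class and put \<open>m = n - q\<close>. A vertex outside \<open>S\<close> loses at most \<open>q\<close>
  neighbours, so a pair \<open>u\<close>, \<open>v\<close> of degree sum at least \<open>n + q + 1\<close> in \<open>G\<close> has degree sum
  at least \<open>m + 1\<close> in \<open>G - S\<close>, which is balanced with classes of size \<open>m\<close>. So everything reduces
  to the case of no deletion.

  For Hamiltonicity, a Hamiltonian cycle through the new edge \<open>uv\<close> leaves a spanning path
  of the old graph from \<open>u\<close> to \<open>v\<close>. On that path \<open>u\<close> has a neighbour whose predecessor is a
  neighbour of \<open>v\<close>: both the neighbours of \<open>v\<close> and the predecessors of the neighbours of \<open>u\<close> lie
  in \<open>U\<close>, which has only \<open>m\<close> elements. Exchanging edges at this place turns the path into a cycle
  (\<open>hamiltonian_if_spanning_path_degree_sum\<close>).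

  Traceability is reduced to Hamiltonicity (\<open>traceable_if_traceable_insert\<close>). A spanning path of a
  balanced graph ends in different classes, say in \<open>x\<close> and \<open>y\<close>; adding the edge \<open>xy\<close> closes it to
  a cycle, the edge \<open>uv\<close> can then be removed by the first part, and removing \<open>xy\<close> from a
  Hamiltonian graph leaves a traceable one.
\<close>

section \<open>Paths and cycles\<close>

lemma split_between_positions:
  assumes "Suc i < length xs"
  obtains as bs where "xs = as @ bs" "as \<noteq> []" "bs \<noteq> []"
    "last as = xs ! i" "hd bs = xs ! Suc i"
proof
  show "xs = take (Suc i) xs @ drop (Suc i) xs" by simp
  show "last (take (Suc i) xs) = xs ! i"
    using assms by (simp add: take_Suc_conv_app_nth del: take_Suc)
  show "take (Suc i) xs \<noteq> []" "drop (Suc i) xs \<noteq> []" "hd (drop (Suc i) xs) = xs ! Suc i"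
    using assms by (auto simp: hd_drop_conv_nth)
qed

lemma is_path_mono: "is_path E xs \<Longrightarrow> E \<subseteq> F \<Longrightarrow> is_path F xs"
  unfolding is_path_def by (auto elim!: successively_mono)

lemma hamiltonian_mono: "hamiltonian W E \<Longrightarrow> E \<subseteq> F \<Longrightarrow> hamiltonian W F"
  unfolding hamiltonian_def is_cycle_def by (blast intro: is_path_mono)

lemma traceable_mono: "traceable W E \<Longrightarrow> E \<subseteq> F \<Longrightarrow> traceable W F"
  unfolding traceable_def by (blast intro: is_path_mono)

lemma traceable_if_hamiltonian: "hamiltonian W E \<Longrightarrow> traceable W E"
  unfolding hamiltonian_def traceable_def is_cycle_def by blast

lemma is_path_rev: "is_path E (rev xs) \<longleftrightarrow> is_path E xs"
  by (simp add: is_path_def insert_commute)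

lemma is_cycle_rotate:
  assumes "is_cycle E (as @ bs)" "as \<noteq> []" "bs \<noteq> []"
  shows "is_cycle E (bs @ as)"
  using assms unfolding is_cycle_def is_path_def
  by (auto simp: successively_append_iff)

text \<open>
  The closing edge of a cycle does not occur between two consecutive vertices of its list; this
  is where the length bound of cycles enters.
\<close>

lemma is_path_if_is_cycle_insert_closing_edge:
  assumes "is_cycle (insert {last xs, hd xs} E) xs"
  shows "is_path E xs"
proof -
  have xs: "xs \<noteq> []" "distinct xs" "length xs \<ge> 3"
    and succ: "\<And>i. Suc i < length xs \<Longrightarrow>
      {xs ! i, xs ! Suc i} \<in> insert {last xs, hd xs} E"
    using assms unfolding is_cycle_def is_path_def successively_conv_nth by auto
  have "{xs ! i, xs ! Suc i} \<in> E" if i: "Suc i < length xs" for i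
  proof -
    have "{xs ! i, xs ! Suc i} \<noteq> {last xs, hd xs}"
      using xs i by (auto simp: last_conv_nth hd_conv_nth doubleton_eq_iff nth_eq_iff_index_eq)
    with succ[OF i] show ?thesis by blast
  qed
  with xs show ?thesis
    unfolding is_path_def successively_conv_nth by blast
qed

text \<open>
  If the cycle uses the edge \<open>xy\<close>, rotating it so that \<open>xy\<close> becomes the closing edge exhibits
  the path.
\<close>

lemma hamiltonian_insert_cases:
  assumes "hamiltonian W (insert {x, y} E)"
  obtains (cycle) "hamiltonian W E"
  | (path) xs where "is_path E xs" "set xs = W" "hd xs = x" "last xs = y"
proof -
  obtain xs where cyc: "is_cycle (insert {x, y} E) xs" and W: "set xs = W"
    using assms unfolding hamiltonian_def by blast
  have oriented: thesis
    if ys: "is_cycle (insert {x, y} E) ys" "set ys = W" "{last ys, hd ys} = {x, y}" for ys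
  proof -
    have ys_path: "is_path E ys"
      using is_path_if_is_cycle_insert_closing_edge[of ys E] ys by simp
    then have "ys \<noteq> []" by (simp add: is_path_def)
    with ys_path ys(2,3) show thesis
      using path[of ys] path[of "rev ys"]
      by (auto simp: is_path_rev hd_rev last_rev doubleton_eq_iff)
  qed
  show thesis
  proof (cases "is_path E xs")
    case True
    show thesis
    proof (cases "{last xs, hd xs} \<in> E")
      case True
      with \<open>is_path E xs\<close> cyc W show thesis
        using cycle unfolding hamiltonian_def is_cycle_def by blast
    next
      case False
      with cyc W show thesis
        using oriented[of xs] unfolding is_cycle_def by auto
    qed
  next
    case False
    then obtain i where i: "Suc i < length xs" "{xs ! i, xs ! Suc i} \<notin> E"
      using cyc unfolding is_cycle_def is_path_def successively_conv_nth by blast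
    then have xy: "{xs ! i, xs ! Suc i} = {x, y}"
      using cyc unfolding is_cycle_def is_path_def successively_conv_nth by blast
    obtain as bs where split: "xs = as @ bs" "as \<noteq> []" "bs \<noteq> []"
        "last as = xs ! i" "hd bs = xs ! Suc i"
      using split_between_positions[OF i(1)] .
    show thesis
    proof (rule oriented)
      show "is_cycle (insert {x, y} E) (bs @ as)"
        using is_cycle_rotate cyc split(1-3) by metis
      show "set (bs @ as) = W"
        using W split(1) by auto
      show "{last (bs @ as), hd (bs @ as)} = {x, y}"
        using split xy by simp
    qed
  qed
qed

lemma traceable_if_hamiltonian_insert:
  assumes "hamiltonian W (insert {x, y} E)"
  shows "traceable W E"
  using assms
proof (cases rule: hamiltonian_insert_cases)
  case cycle
  then show ?thesis by (rule traceable_if_hamiltonian)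
next
  case (path xs)
  then show ?thesis unfolding traceable_def by blast
qed

text \<open>
  The chords from \<open>last as\<close> to \<open>last bs\<close> and from \<open>hd as\<close> to \<open>hd bs\<close> replace the edge that joins
  the two parts of the path.
\<close>

lemma is_cycle_if_crossing_chords:
  assumes "is_path E (as @ bs)" "as \<noteq> []" "bs \<noteq> []" "length (as @ bs) \<ge> 3"
    and "{last as, last bs} \<in> E" "{hd as, hd bs} \<in> E"
  shows "is_cycle E (as @ rev bs)"
  using assms unfolding is_cycle_def is_path_def
  by (auto simp: successively_append_iff hd_rev last_rev insert_commute)

section \<open>Joining one pair in a balanced bipartite graph\<close>

lemma bipartite_graph_edge_iff:
  assumes "bipartite_graph U V E" "{x, y} \<in> E"
  shows "x \<in> U \<union> V" "y \<in> U \<union> V" "x \<in> U \<longleftrightarrow> y \<in> V" "x \<in> V \<longleftrightarrow> y \<in> U"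
  using assms unfolding bipartite_graph_def
  by (fastforce simp: doubleton_eq_iff)+

lemma bipartite_graph_swap: "bipartite_graph U V E \<Longrightarrow> bipartite_graph V U E"
  unfolding bipartite_graph_def by (metis inf_commute insert_commute)

lemma bipartite_graph_insert:
  "bipartite_graph U V E \<Longrightarrow> x \<in> U \<Longrightarrow> y \<in> V \<Longrightarrow> bipartite_graph U V (insert {x, y} E)"
  unfolding bipartite_graph_def by auto

lemma card_indices_in:
  assumes "distinct xs" "A \<subseteq> set xs"
  shows "card {i. i < length xs \<and> xs ! i \<in> A} = card A"
proof (rule bij_betw_same_card)
  show "bij_betw ((!) xs) {i. i < length xs \<and> xs ! i \<in> A} A"
    using assms by (fastforce simp: bij_betw_def inj_on_def in_set_conv_nth nth_eq_iff_index_eq)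
qed

text \<open>
  Let \<open>u\<close> and \<open>v\<close> be the first and the last vertex of the path. The set \<open>P\<close> in the proof
  consists of the positions just before a neighbour of \<open>u\<close>, and \<open>Q\<close> of the positions of the
  neighbours of \<open>v\<close>. Both contain positions of vertices of \<open>U\<close> only, of which there are fewer
  than the degree sum, so they meet, and at a common position the path can be closed to a cycle.
\<close>

lemma hamiltonian_if_spanning_path_degree_sum:
  assumes G: "bipartite_graph U V E"
    and path: "is_path E xs" "set xs = U \<union> V" "hd xs \<in> U" "last xs \<in> V"
    and nonadj: "{hd xs, last xs} \<notin> E"
    and deg: "degree E (hd xs) + degree E (last xs) > card U"
  shows "hamiltonian (U \<union> V) E"
proof -
  define u v where "u = hd xs" and "v = last xs"
  have xs: "xs \<noteq> []" "distinct xs"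
    and succ: "\<And>i. Suc i < length xs \<Longrightarrow> {xs ! i, xs ! Suc i} \<in> E"
    using path(1) unfolding is_path_def successively_conv_nth by auto
  have u0: "xs ! 0 = u" and vl: "xs ! (length xs - 1) = v"
    using xs by (simp_all add: u_def v_def hd_conv_nth last_conv_nth)
  have disj: "U \<inter> V = {}"
    using G by (simp add: bipartite_graph_def)
  define I where "I = {i. i < length xs \<and> xs ! i \<in> U}"
  define P where "P = {i. Suc i < length xs \<and> {u, xs ! Suc i} \<in> E}"
  define Q where "Q = {i. Suc i < length xs \<and> {xs ! i, v} \<in> E}"
  have nbU: "y \<in> V" if "{u, y} \<in> E" for y
    using bipartite_graph_edge_iff(3)[OF G that] path(3) by (simp add: u_def v_def)
  have nbV: "y \<in> U" if "{v, y} \<in> E" for y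
    using bipartite_graph_edge_iff(4)[OF G that] path(4) by (simp add: u_def v_def)
  have "P \<subseteq> I"
    using succ nbU bipartite_graph_edge_iff(3)[OF G] unfolding P_def I_def
    by (auto dest: Suc_lessD)
  moreover have "Q \<subseteq> I"
    using nbV unfolding Q_def I_def by (auto simp: insert_commute)
  moreover have cardI: "card I = card U"
    using card_indices_in[OF xs(2), of U] path(2) by (simp add: I_def)
  moreover have "finite I" by (simp add: I_def)
  moreover have "card P = degree E u"
  proof -
    have "Suc ` P = {i. i < length xs \<and> xs ! i \<in> {y. {u, y} \<in> E}}"
    proof -
      \<comment> \<open>Position 0 carries \<open>u\<close> itself, which is not its own neighbour.\<close>
      have "i \<noteq> 0" if "{u, xs ! i} \<in> E" for i
        using nbU[OF that] u0 path(3) disj by (auto simp: u_def v_def)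
      then show ?thesis
        unfolding P_def by (auto simp: image_iff gr0_conv_Suc)
    qed
    moreover have "{y. {u, y} \<in> E} \<subseteq> set xs"
      using nbU path(2) by auto
    ultimately show ?thesis
      using card_indices_in[OF xs(2), of "{y. {u, y} \<in> E}"] card_image[of Suc P]
      unfolding degree_def by simp
  qed
  moreover have "card Q = degree E v"
  proof -
    have "Suc i < length xs" if "{xs ! i, v} \<in> E" "i < length xs" for i
    proof -
      have "xs ! i \<in> U"
        using nbV that(1) by (simp add: insert_commute)
      then have "i \<noteq> length xs - 1"
        using vl path(4) disj by (auto simp: u_def v_def)
      with that(2) show ?thesis by linarith
    qed
    then have "Q = {i. i < length xs \<and> xs ! i \<in> {y. {v, y} \<in> E}}"
      unfolding Q_def by (auto simp: insert_commute)
    moreover have "{y. {v, y} \<in> E} \<subseteq> set xs"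
      using nbV path(2) by auto
    ultimately show ?thesis
      using card_indices_in[OF xs(2), of "{y. {v, y} \<in> E}"] unfolding degree_def by simp
  qed
  moreover have "card (P \<union> Q) \<le> card I"
    using calculation by (intro card_mono) auto
  ultimately have "P \<inter> Q \<noteq> {}"
    using deg card_Un_disjoint[of P Q] finite_subset[of _ I] by (auto simp: u_def v_def)
  then obtain i where i: "Suc i < length xs" "{u, xs ! Suc i} \<in> E" "{xs ! i, v} \<in> E"
    by (auto simp: P_def Q_def)
  obtain as bs where split: "xs = as @ bs" "as \<noteq> []" "bs \<noteq> []"
      "last as = xs ! i" "hd bs = xs ! Suc i"
    using split_between_positions[OF i(1)] .
  have ends: "hd as = u" "last bs = v"
    using split(1-3) by (auto simp: u_def v_def)
  \<comment> \<open>On two vertices the chords would both be the missing edge between \<open>u\<close> and \<open>v\<close>.\<close>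
  have "length xs \<noteq> 2"
    using i nonadj u0 by (auto simp: u_def v_def less_Suc_eq)
  with i(1) have "length (as @ bs) \<ge> 3"
    using split(1) by auto
  then have "is_cycle E (as @ rev bs)"
    using is_cycle_if_crossing_chords[of E as bs] path(1) split ends i by simp
  moreover have "set (as @ rev bs) = U \<union> V"
    using split(1) path(2) by auto
  ultimately show ?thesis
    unfolding hamiltonian_def by blast
qed

lemma hamiltonian_if_hamiltonian_insert:
  assumes G: "bipartite_graph U V E" and uv: "u \<in> U" "v \<in> V"
    and deg: "degree E u + degree E v > card U"
    and ham: "hamiltonian (U \<union> V) (insert {u, v} E)"
  shows "hamiltonian (U \<union> V) E"
proof (cases "{u, v} \<in> E")
  case True
  with ham show ?thesis by (simp add: insert_absorb)
next
  case False
  from ham show ?thesis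
  proof (cases rule: hamiltonian_insert_cases)
    case cycle
    then show ?thesis .
  next
    case (path xs)
    with False uv deg show ?thesis
      using hamiltonian_if_spanning_path_degree_sum[OF G path(1,2)] by simp
  qed
qed

text \<open>
  Otherwise every vertex of \<open>V\<close> would have a successor on the path, which lies in \<open>U\<close> and
  differs from the first vertex, so that \<open>V\<close> would be smaller than \<open>U\<close>.
\<close>

lemma spanning_path_last_if_hd:
  assumes G: "bipartite_graph U V E" "card U = card V"
    and path: "is_path E xs" "set xs = U \<union> V" "hd xs \<in> U"
  shows "last xs \<in> V"
proof (rule ccontr)
  assume last: "last xs \<notin> V"
  have xs: "xs \<noteq> []" "distinct xs"
    and succ: "\<And>i. Suc i < length xs \<Longrightarrow> {xs ! i, xs ! Suc i} \<in> E"
    using path(1) unfolding is_path_def successively_conv_nth by auto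
  define I where "I = {i. i < length xs \<and> xs ! i \<in> U}"
  define J where "J = {i. i < length xs \<and> xs ! i \<in> V}"
  have "Suc i \<in> I" if "i \<in> J" for i
  proof -
    have "i \<noteq> length xs - 1"
      using that last xs by (auto simp: J_def last_conv_nth)
    with that have "Suc i < length xs"
      by (auto simp: J_def)
    then show ?thesis
      using succ bipartite_graph_edge_iff(4)[OF G(1)] that by (auto simp: I_def J_def)
  qed
  moreover have "0 \<in> I"
    using path(3) xs by (simp add: I_def hd_conv_nth)
  ultimately have "Suc ` J \<subset> I" by auto
  then have "card (Suc ` J) < card I"
    by (intro psubset_card_mono) (simp add: I_def)
  then have "card V < card U"
    using card_indices_in[OF xs(2)] path(2) by (simp add: I_def J_def card_image)
  with G(2) show False by simp
qed

lemma traceable_if_traceable_insert: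
  assumes G: "bipartite_graph U V E" "card U = card V" and uv: "u \<in> U" "v \<in> V"
    and deg: "degree E u + degree E v > card U"
    and tr: "traceable (U \<union> V) (insert {u, v} E)"
  shows "traceable (U \<union> V) E"
proof (cases "{u, v} \<in> E")
  case True
  with tr show ?thesis by (simp add: insert_absorb)
next
  case False
  let ?F = "insert {u, v} E"
  have F: "bipartite_graph U V ?F"
    using bipartite_graph_insert G(1) uv by metis
  have fin: "finite U" "finite V" "U \<inter> V = {}"
    using G(1) by (auto simp: bipartite_graph_def)
  obtain ys where ys: "is_path ?F ys" "set ys = U \<union> V"
    using tr unfolding traceable_def by blast
  have ys_ne: "ys \<noteq> []"
    using ys(1) by (simp add: is_path_def)
  have "\<exists>xs. is_path ?F xs \<and> set xs = U \<union> V \<and> hd xs \<in> U \<and> last xs \<in> V"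
  proof (cases "hd ys \<in> U")
    case True
    then show ?thesis
      using ys spanning_path_last_if_hd[OF F G(2) ys] by blast
  next
    case False
    then have "hd ys \<in> V"
      using ys(2) ys_ne by (metis UnE hd_in_set)
    moreover from this have "last ys \<in> U"
      using spanning_path_last_if_hd[OF bipartite_graph_swap[OF F]] G(2) ys
      by (simp add: Un_commute)
    ultimately show ?thesis
      using ys ys_ne by (intro exI[of _ "rev ys"]) (simp add: is_path_rev hd_rev last_rev)
  qed
  then obtain xs where xs: "is_path ?F xs" "set xs = U \<union> V" "hd xs \<in> U" "last xs \<in> V"
    by blast
  define x y where "x = hd xs" and "y = last xs"
  \<comment> \<open>As \<open>u\<close> and \<open>v\<close> are not adjacent, the degree sum leaves room for a second vertex in each
    class, and the closed path is not just an edge traversed back and forth.\<close>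
  have "length xs \<ge> 3"
  proof -
    have "{y. {u, y} \<in> E} \<subseteq> V - {v}" "{y. {v, y} \<in> E} \<subseteq> U - {u}"
      using False bipartite_graph_edge_iff(3,4)[OF G(1)] uv by (auto simp: insert_commute)
    then have "degree E u \<le> card (V - {v})" "degree E v \<le> card (U - {u})"
      using fin unfolding degree_def by (simp_all add: card_mono)
    then have "2 * (card U - 1) > card U"
      using deg uv fin G(2) by (simp add: card_Diff_singleton)
    moreover have "length xs = card U + card V"
      using xs(1,2) fin distinct_card[of xs] by (simp add: is_path_def card_Un_disjoint)
    ultimately show ?thesis using G(2) by linarith
  qed
  with xs(1) have "is_cycle (insert {x, y} ?F) xs"
    unfolding is_cycle_def x_def y_def
    by (auto intro: is_path_mono simp: insert_commute)
  with xs(2) have "hamiltonian (U \<union> V) (insert {u, v} (insert {x, y} E))"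
    unfolding hamiltonian_def by (metis insert_commute)
  moreover have xyE: "bipartite_graph U V (insert {x, y} E)"
    using bipartite_graph_insert[OF G(1)] xs(3,4) by (simp add: x_def y_def)
  moreover have "degree (insert {x, y} E) u + degree (insert {x, y} E) v > card U"
    using deg degree_mono[OF xyE, of E u] degree_mono[OF xyE, of E v]
    by (simp add: subset_insertI)
  ultimately have "hamiltonian (U \<union> V) (insert {x, y} E)"
    using hamiltonian_if_hamiltonian_insert uv by metis
  then show ?thesis by (rule traceable_if_hamiltonian_insert)
qed

section \<open>Deleting vertices and iterating\<close>

lemma bipartite_graph_delete_vertices:
  assumes "bipartite_graph U V E"
  shows "bipartite_graph (U - S) (V - S) (delete_vertices E S)"
  using assms unfolding bipartite_graph_def delete_vertices_def by fastforce

lemma degree_delete_vertices: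
  assumes G: "bipartite_graph U V E" and u: "u \<in> U - S"
  shows "degree E u \<le> degree (delete_vertices E S) u + card (S \<inter> V)"
proof -
  have "{y. {u, y} \<in> E} \<subseteq> {y. {u, y} \<in> delete_vertices E S} \<union> (S \<inter> V)"
    using u bipartite_graph_edge_iff(3)[OF G] by (auto simp: delete_vertices_def)
  moreover have "finite ({y. {u, y} \<in> delete_vertices E S} \<union> (S \<inter> V))"
    using finite_neighbours[OF bipartite_graph_delete_vertices[OF G]] G
    by (simp add: bipartite_graph_def)
  ultimately have "degree E u \<le> card ({y. {u, y} \<in> delete_vertices E S} \<union> (S \<inter> V))"
    unfolding degree_def by (intro card_mono)
  also have "\<dots> \<le> degree (delete_vertices E S) u + card (S \<inter> V)"
    unfolding degree_def by (rule card_Un_le)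
  finally show ?thesis .
qed

text \<open>
  A joining step either disappears with the deleted vertices or is a joining step of the
  remaining balanced graph, whose classes have \<open>q\<close> vertices less, with a degree sum that is
  smaller by at most \<open>2 * q\<close>.
\<close>

lemma closure_step_delete_vertices:
  assumes step: "closure_step (card U + q + 1) U V E E'"
    and G: "bipartite_graph U V E"
    and S: "card (S \<inter> U) = q" "card (S \<inter> V) = q"
  obtains "delete_vertices E' S = delete_vertices E S"
  | u v where "u \<in> U - S" "v \<in> V - S"
      "delete_vertices E' S = insert {u, v} (delete_vertices E S)"
      "degree (delete_vertices E S) u + degree (delete_vertices E S) v > card (U - S)"
proof -
  obtain u v where uv: "u \<in> U" "v \<in> V" "degree E u + degree E v \<ge> card U + q + 1"
      "E' = insert {u, v} E"
    using step by (auto elim: closure_step.cases)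
  show thesis
  proof (cases "u \<in> S \<or> v \<in> S")
    case True
    with uv(4) show thesis
      using that(1) by (auto simp: delete_vertices_def)
  next
    case False
    have "finite U"
      using G by (simp add: bipartite_graph_def)
    then have "card (U - S) + q = card U"
      using S(1) card_Diff_subset_Int[of U S] card_mono[of U "U \<inter> S"]
      by (simp add: Int_commute)
    moreover have "degree E u \<le> degree (delete_vertices E S) u + q"
      using degree_delete_vertices[OF G, of u S] uv(1) False S(2) by simp
    moreover have "degree E v \<le> degree (delete_vertices E S) v + q"
      using degree_delete_vertices[OF bipartite_graph_swap[OF G], of v S] uv(2) False S(1)
      by simp
    ultimately have "degree (delete_vertices E S) u + degree (delete_vertices E S) v
        > card (U - S)"
      using uv(3) by linarith
    moreover have "delete_vertices E' S = insert {u, v} (delete_vertices E S)"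
      using False uv(4) by (auto simp: delete_vertices_def)
    ultimately show thesis
      using that(2) uv(1,2) False by blast
  qed
qed

lemma card_Diff_balanced:
  assumes "balanced_bipartite_graph U V E" "card (S \<inter> U) = card (S \<inter> V)"
  shows "card (U - S) = card (V - S)"
  using assms card_Diff_subset_Int[of U S] card_Diff_subset_Int[of V S]
  by (simp add: balanced_bipartite_graph_def bipartite_graph_def Int_commute)

lemma hamiltonian_delete_vertices_step_iff:
  assumes step: "closure_step (card U + q + 1) U V E E'"
    and G: "bipartite_graph U V E"
    and S: "card (S \<inter> U) = q" "card (S \<inter> V) = q"
  shows "hamiltonian (U \<union> V - S) (delete_vertices E' S)
    \<longleftrightarrow> hamiltonian (U \<union> V - S) (delete_vertices E S)"
  using step G S
proof (cases rule: closure_step_delete_vertices)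
  case 1
  then show ?thesis by simp
next
  case (2 u v)
  then show ?thesis
    using hamiltonian_if_hamiltonian_insert[OF bipartite_graph_delete_vertices[OF G] 2(1,2,4)]
      hamiltonian_mono[OF _ subset_insertI]
    by (auto simp: Un_Diff)
qed

lemma traceable_delete_vertices_step_iff:
  assumes step: "closure_step (card U + q + 1) U V E E'"
    and G: "balanced_bipartite_graph U V E"
    and S: "card (S \<inter> U) = q" "card (S \<inter> V) = q"
  shows "traceable (U \<union> V - S) (delete_vertices E' S)
    \<longleftrightarrow> traceable (U \<union> V - S) (delete_vertices E S)"
proof -
  have bip: "bipartite_graph U V E"
    using G by (simp add: balanced_bipartite_graph_def)
  from step bip S show ?thesis
  proof (cases rule: closure_step_delete_vertices)
    case 1
    then show ?thesis by simp
  next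
    case (2 u v)
    have "card (U - S) = card (V - S)"
      using card_Diff_balanced[OF G] S by simp
    with 2 show ?thesis
      using traceable_if_traceable_insert[OF bipartite_graph_delete_vertices[OF bip] _ 2(1,2,4)]
        traceable_mono[OF _ subset_insertI]
      by (auto simp: Un_Diff)
  qed
qed

lemma qq_properties_closure_steps_iff:
  assumes "(closure_step (card U + q + 1) U V)\<^sup>*\<^sup>* E H" "balanced_bipartite_graph U V E"
  shows "(qq_hamiltonian q U V E \<longleftrightarrow> qq_hamiltonian q U V H)
    \<and> (qq_traceable q U V E \<longleftrightarrow> qq_traceable q U V H)"
  using assms(1)
proof (induction rule: rtranclp_induct)
  case base
  show ?case by simp
next
  case (step F F')
  have "balanced_bipartite_graph U V F"
    using bipartite_graph_steps[OF step.hyps(1)] assms(2)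
    by (simp add: balanced_bipartite_graph_def)
  then have "qq_hamiltonian q U V F' \<longleftrightarrow> qq_hamiltonian q U V F"
    and "qq_traceable q U V F' \<longleftrightarrow> qq_traceable q U V F"
    unfolding qq_hamiltonian_def qq_traceable_def
    using hamiltonian_delete_vertices_step_iff[OF step.hyps(2)]
      traceable_delete_vertices_step_iff[OF step.hyps(2)]
    by (auto simp: balanced_bipartite_graph_def)
  with step.IH show ?case by blast
qed

theorem proposition1p13:
  fixes U V :: "'a set" and E :: "'a set set" and n q :: nat
  assumes "balanced_bipartite_graph U V E"
    and "card (U \<union> V) = 2 * n"
  shows "(qq_hamiltonian q U V E \<longleftrightarrow> qq_hamiltonian q U V (bipartite_closure (n + q + 1) U V E))
    \<and> (qq_traceable q U V E \<longleftrightarrow> qq_traceable q U V (bipartite_closure (n + q + 1) U V E))"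
proof -
  have G: "bipartite_graph U V E"
    using assms(1) by (simp add: balanced_bipartite_graph_def)
  have "card U = n"
    using assms by (simp add: balanced_bipartite_graph_def bipartite_graph_def card_Un_disjoint)
  moreover have "(closure_step (n + q + 1) U V)\<^sup>*\<^sup>* E (bipartite_closure (n + q + 1) U V E)"
    using is_bipartite_closure_bipartite_closure[OF G] by (simp add: is_bipartite_closure_def)
  ultimately show ?thesis
    using qq_properties_closure_steps_iff[OF _ assms(1)] by simp
qed

end
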